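(* Let $D\in\mathcal{D}_d$ be convex with a smooth boundary. If the random vector $\mathbf X$ has a light-tailed homothetic density $f\in\mathcal{H}(D)$, then for any two distinct unit vectors $\mathbf a,\mathbf b\in\mathbb{R}^d$ the random variables $\mathbf a^T\mathbf X$ and $\mathbf b^T\mathbf X$ are asymptotically independent. The result remains valid if (instead of $f \in \mathcal{H}(D)$ being light-tailed) the density of $\mathbf X$ is in $\mathcal{A}(D)$.
   Context: A set $D\subset\mathbb{R}^d$ is star-shaped if $\mathbf x\in D$ implies $r\mathbf x\in D$ for $0<r<1$. For a non-empty bounded open star-shaped set $D$, let $D_\infty=\bigcup_{n>0} nD$ (an open cone), with gauge function $n_D(\mathbf x)=\inf\{t>0:\mathbf x\in tD\}$ on $D_\infty$, so that $n_D(t\mathbf x)=tn_D(\mathbf x)$ for $t>0$. $\mathcal{D}_d$ is the class of all (non-empty) bounded open star-shaped sets $D\subset\mathbb{R}^d$ for which $D_\infty$ is convex, $n_D$ is continuous on $D_\infty$, and $D=\{\mathbf x\in D_\infty: n_D(\mathbf x)<1\}$. A probability density $f$ on $\mathbb{R}^d$ is in $\mathcal{H}(D)$, $D\in\mathcal{D}_d$, if $f(\mathbf x)=f_0(n_D(\mathbf x))$ on $D_\infty$ and $f\equiv 0$ off $D_\infty$, where $f_0:[0,\infty)\to[0,\infty)$ (the generator) is decreasing, positive and continuous. Such $f$ is light-tailed if $f_0$ is continuous, positive and strictly decreasing on $[0,\infty)$, and there is a strictly increasing sequence $r_n>0$ with $r_{n+1}/r_n\to 1$ and $f_0(r_n)/f_0(r_{n+1})\to\infty$.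 For $D\in\mathcal{D}_d$, a continuous positive probability density $f$ on $\mathbb{R}^d$ belongs to $\mathcal{A}(D)$ if there exist sequences $c_n>0$ and $r_n\to\infty$ with $c_{n+1}/c_n\to 0$ and $r_{n+1}/r_n\to 1$ such that for every $\epsilon>0$, for all sufficiently large $n$, $e^{-\epsilon}r_nD\subset\{f>c_n\}\subset e^{\epsilon}r_nD$. A bounded open convex set $D$ has a smooth boundary if for each boundary point $\mathbf p$ there is a unique hyperplane which contains $\mathbf p$ and does not intersect $D$. Asymptotic independence: let $(X,Y)$ be a random vector with distribution function $F$ with continuous marginals $F_1,F_2$. Let $P$ be the function on $[0,1]^2$ determined by $P(F_1(x),F_2(y))=\mathbb{P}\{X>x,Y>y\}$; equivalently $P(u,v)=1+C(u,v)-u-v$ where $C$ is the copula of $F$. Then $X$ and $Y$ are asymptotically independent if $P(1-s,1-s)=o(s)$ as $s\downarrow 0$. *)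

theory Defs
  imports "HOL-Probability.Probability"
begin

definition star_shaped :: "'a::real_vector set \<Rightarrow> bool" where
  "star_shaped D \<longleftrightarrow> (\<forall>x\<in>D. \<forall>r::real. 0 < r \<and> r < 1 \<longrightarrow> r *\<^sub>R x \<in> D)"

definition cone_of :: "'a::real_vector set \<Rightarrow> 'a set" where
  "cone_of D = (\<Union>n\<in>{n::nat. 0 < n}. (*\<^sub>R) (real n) ` D)"

text \<open>Only meaningful on \<^term>\<open>cone_of D\<close>: elsewhere the set below is empty and its
  infimum is unspecified.\<close>
definition gauge_fn :: "'a::real_vector set \<Rightarrow> 'a \<Rightarrow> real" where
  "gauge_fn D x = Inf {t. 0 < t \<and> x \<in> (*\<^sub>R) t ` D}"

definition class_D :: "(real ^ 'd) set set" where
  "class_D = {D. D \<noteq> {} \<and> bounded D \<and> open D \<and> star_shaped D \<and>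
     convex (cone_of D) \<and> continuous_on (cone_of D) (gauge_fn D) \<and>
     D = {x \<in> cone_of D. gauge_fn D x < 1}}"

definition prob_density :: "(real ^ 'd \<Rightarrow> real) \<Rightarrow> bool" where
  "prob_density f \<longleftrightarrow> f \<in> borel_measurable borel \<and> (\<forall>x. 0 \<le> f x) \<and>
     (\<integral>\<^sup>+x. ennreal (f x) \<partial>lborel) = 1"

text \<open>The generator is a function on the half-line \<open>[0,\<infinity>)\<close>; its values at negative
  arguments are irrelevant. It is determined by the density on \<open>[0,\<infinity>)\<close> (for \<open>D\<close> in
  \<^term>\<open>class_D\<close>), so existential quantification over generators is harmless.\<close>
definition is_generator :: "(real ^ 'd) set \<Rightarrow> (real ^ 'd \<Rightarrow> real) \<Rightarrow> (real \<Rightarrow> real) \<Rightarrow> bool" where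
  "is_generator D f f0 \<longleftrightarrow>
     antimono_on {0..} f0 \<and> (\<forall>t\<ge>0. 0 < f0 t) \<and> continuous_on {0..} f0 \<and>
     (\<forall>x\<in>cone_of D. f x = f0 (gauge_fn D x)) \<and> (\<forall>x. x \<notin> cone_of D \<longrightarrow> f x = 0)"

definition class_H :: "(real ^ 'd) set \<Rightarrow> (real ^ 'd \<Rightarrow> real) set" where
  "class_H D = {f. prob_density f \<and> (\<exists>f0. is_generator D f f0)}"

definition light_tailed_generator :: "(real \<Rightarrow> real) \<Rightarrow> bool" where
  "light_tailed_generator f0 \<longleftrightarrow>
     continuous_on {0..} f0 \<and> (\<forall>t\<ge>0. 0 < f0 t) \<and> strict_antimono_on {0..} f0 \<and>
     (\<exists>r::nat \<Rightarrow> real. (\<forall>n. 0 < r n) \<and> strict_mono r \<and>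
        (\<lambda>n. r (Suc n) / r n) \<longlonglongrightarrow> 1 \<and>
        filterlim (\<lambda>n. f0 (r n) / f0 (r (Suc n))) at_top sequentially)"

definition light_tailed :: "(real ^ 'd) set \<Rightarrow> (real ^ 'd \<Rightarrow> real) \<Rightarrow> bool" where
  "light_tailed D f \<longleftrightarrow> (\<exists>f0. is_generator D f f0 \<and> light_tailed_generator f0)"

definition class_A :: "(real ^ 'd) set \<Rightarrow> (real ^ 'd \<Rightarrow> real) set" where
  "class_A D = {f. prob_density f \<and> continuous_on UNIV f \<and> (\<forall>x. 0 < f x) \<and>
     (\<exists>(c::nat \<Rightarrow> real) (r::nat \<Rightarrow> real).
        (\<forall>n. 0 < c n) \<and> filterlim r at_top sequentially \<and>
        (\<lambda>n. c (Suc n) / c n) \<longlonglongrightarrow> 0 \<and> (\<lambda>n. r (Suc n) / r n) \<longlonglongrightarrow> 1 \<and>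
        (\<forall>\<epsilon>>0. \<forall>\<^sub>F n in sequentially.
            (*\<^sub>R) (exp (- \<epsilon>) * r n) ` D \<subseteq> {x. c n < f x} \<and>
            {x. c n < f x} \<subseteq> (*\<^sub>R) (exp \<epsilon> * r n) ` D))}"

definition hyperplane :: "(real ^ 'd) set \<Rightarrow> bool" where
  "hyperplane H \<longleftrightarrow> (\<exists>u c. u \<noteq> 0 \<and> H = {x. u \<bullet> x = c})"

definition smooth_boundary :: "(real ^ 'd) set \<Rightarrow> bool" where
  "smooth_boundary D \<longleftrightarrow> (\<forall>p\<in>frontier D. \<exists>!H. hyperplane H \<and> p \<in> H \<and> H \<inter> D = {})"

definition is_exceedance_fn ::
  "'w measure \<Rightarrow> ('w \<Rightarrow> real) \<Rightarrow> ('w \<Rightarrow> real) \<Rightarrow> (real \<Rightarrow> real \<Rightarrow> real) \<Rightarrow> bool" where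
  "is_exceedance_fn M X Y P \<longleftrightarrow>
     (\<forall>x y. P (cdf (distr M borel X) x) (cdf (distr M borel Y) y) =
        measure M {\<omega> \<in> space M. x < X \<omega> \<and> y < Y \<omega>})"

definition asymp_independent ::
  "'w measure \<Rightarrow> ('w \<Rightarrow> real) \<Rightarrow> ('w \<Rightarrow> real) \<Rightarrow> bool" where
  "asymp_independent M X Y \<longleftrightarrow>
     X \<in> borel_measurable M \<and> Y \<in> borel_measurable M \<and>
     continuous_on UNIV (cdf (distr M borel X)) \<and> continuous_on UNIV (cdf (distr M borel Y)) \<and>
     (\<exists>P. is_exceedance_fn M X Y P \<and> (\<lambda>s. P (1 - s) (1 - s)) \<in> o[at_right 0](\<lambda>s. s))"

text \<open>The choice of \<open>P\<close> in the preceding definition is immaterial: the marginals being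
  continuous, \<open>P\<close> is determined on the open unit square.\<close>

lemma cdf_attains:
  assumes "prob_space M" "X \<in> borel_measurable M" "continuous_on UNIV (cdf (distr M borel X))"
    and "0 < u" "u < 1"
  shows "\<exists>x. cdf (distr M borel X) x = u"
proof -
  let ?F = "cdf (distr M borel X)"
  interpret real_distribution "distr M borel X"
    using assms by (simp add: prob_space.real_distribution_distr)
  obtain l where l: "?F l < u"
    using order_tendstoD(2)[OF cdf_lim_at_bot \<open>0 < u\<close>] eventually_happens
    by (metis trivial_limit_at_bot_linorder)
  obtain h where h: "u < ?F h"
    using order_tendstoD(1)[OF cdf_lim_at_top_prob \<open>u < 1\<close>] eventually_happens
    by (metis trivial_limit_at_top_linorder)
  have "l \<le> h"
    using l h cdf_nondecreasing[of h l] by linarith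
  then show ?thesis
    using IVT'[of ?F l u h] l h assms(3) continuous_on_subset
    by (metis less_imp_le subset_UNIV)
qed

lemma is_exceedance_fn_unique:
  assumes "prob_space M" "X \<in> borel_measurable M" "Y \<in> borel_measurable M"
    and "continuous_on UNIV (cdf (distr M borel X))" "continuous_on UNIV (cdf (distr M borel Y))"
    and "is_exceedance_fn M X Y P" "is_exceedance_fn M X Y Q"
    and "0 < u" "u < 1" "0 < v" "v < 1"
  shows "P u v = Q u v"
proof -
  obtain x y where "cdf (distr M borel X) x = u" "cdf (distr M borel Y) y = v"
    using cdf_attains assms by metis
  then show ?thesis
    using assms(6,7) unfolding is_exceedance_fn_def by metis
qed

end

theory Submission imports Defs begin

text \<open>Let \<open>\<alpha>\<close> and \<open>\<beta>\<close> be the support values of \<open>D\<close> in the directions \<open>a\<close> and \<open>b\<close>. By smoothness no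
  boundary point is extremal in both directions, so for some \<open>q > 1\<close> and large \<open>t\<close> the intersection of
  the half-spaces \<open>a \<bullet> x > t \<alpha>\<close> and \<open>b \<bullet> x > t \<beta>\<close> misses \<open>q t D\<close>. In both classes the level sets
  of \<open>f\<close> at a rapidly decreasing sequence of heights are close to multiples \<open>r\<^sub>n D\<close> with slowly
  varying \<open>r\<^sub>n\<close>, hence the mass outside \<open>q t D\<close> is negligible against the mass of either half-space
  whose support value is positive.\<close>

section \<open>Scaling of star-shaped sets, Lebesgue measure and a summation device\<close>

lemma mem_scaleR_image_iff:
  fixes x :: "'a::real_vector"
  assumes "t \<noteq> 0"
  shows "x \<in> (*\<^sub>R) t ` S \<longleftrightarrow> (1 / t) *\<^sub>R x \<in> S"
proof
  assume "x \<in> (*\<^sub>R) t ` S"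
  then show "(1 / t) *\<^sub>R x \<in> S" using assms by auto
next
  assume "(1 / t) *\<^sub>R x \<in> S"
  then have "t *\<^sub>R (1 / t) *\<^sub>R x \<in> (*\<^sub>R) t ` S" by (rule imageI)
  then show "x \<in> (*\<^sub>R) t ` S" using assms by simp
qed

lemma star_shaped_scale_mono:
  assumes "star_shaped D" "0 < s" "s \<le> t"
  shows "(*\<^sub>R) s ` D \<subseteq> (*\<^sub>R) t ` D"
proof
  fix x assume x: "x \<in> (*\<^sub>R) s ` D"
  show "x \<in> (*\<^sub>R) t ` D"
  proof (cases "s = t")
    case False
    then have "0 < s / t" "s / t < 1" using assms by auto
    moreover have "(1 / s) *\<^sub>R x \<in> D" using x assms by (simp add: mem_scaleR_image_iff)
    ultimately have "(s / t) *\<^sub>R (1 / s) *\<^sub>R x \<in> D"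
      using assms(1) unfolding star_shaped_def by blast
    then show ?thesis using assms by (simp add: mem_scaleR_image_iff)
  qed (use x in simp)
qed

text \<open>The origin itself may lie outside \<open>D\<close>, for instance when the cone of
  \<open>D\<close> is proper. Its being a limit of points of \<open>D\<close> is what makes support
  values nonnegative.\<close>

lemma zero_in_closure_star_shaped:
  fixes D :: "'a::real_normed_vector set"
  assumes "star_shaped D" "D \<noteq> {}"
  shows "0 \<in> closure D"
proof -
  obtain x where x: "x \<in> D" using assms(2) by blast
  \<comment> \<open>Starting at 1/2 keeps every factor strictly below 1, as star-shapedness
    demands.\<close>
  have "(\<lambda>n. (1 / real (Suc (Suc n))) *\<^sub>R x) \<longlonglongrightarrow> 0 *\<^sub>R x"
    by (intro tendsto_intros LIMSEQ_Suc[OF LIMSEQ_Suc[OF lim_1_over_n]])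
  moreover have "(1 / real (Suc (Suc n))) *\<^sub>R x \<in> D" for n
    using assms(1) x unfolding star_shaped_def by (force simp: field_simps)
  ultimately show ?thesis
    unfolding closure_sequential by (intro exI[of _ "\<lambda>n. (1 / real (Suc (Suc n))) *\<^sub>R x"]) simp
qed

lemma inner_le_on_closure:
  fixes D :: "'a::euclidean_space set"
  assumes "\<And>x. x \<in> D \<Longrightarrow> u \<bullet> x \<le> m" "p \<in> closure D"
  shows "u \<bullet> p \<le> m"
proof -
  have "closure D \<subseteq> {x. u \<bullet> x \<le> m}"
    using assms(1) by (intro closure_minimal closed_halfspace_le) blast
  then show ?thesis using assms(2) by blast
qed

lemma measure_lborel_scale:
  fixes S :: "'a::euclidean_space set"
  assumes "open S" "0 < t"
  shows "measure lborel ((*\<^sub>R) t ` S) = t ^ DIM('a) * measure lborel S"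
proof -
  have "open ((*\<^sub>R) t ` S)" using assms by (simp add: open_scaling)
  then show ?thesis
    using measure_lebesgue_affine[of t 0 S] assms by (simp add: measure_completion borel_open)
qed

lemma measure_lborel_open_pos:
  fixes S :: "'a::euclidean_space set"
  assumes "open S" "bounded S" "S \<noteq> {}"
  shows "0 < measure lborel S"
proof -
  have "measure lebesgue S \<noteq> 0"
    using assms open_not_negligible[of S] negligible_iff_measure[of S] lmeasurable_open by blast
  then show ?thesis
    using assms by (simp add: measure_completion borel_open less_le)
qed

text \<open>The difference \<open>T n - 2 * V n\<close> is eventually nondecreasing and is bounded
  by terms of \<open>T\<close>, which tend to 0, so it cannot be positive. This replaces summing a
  geometric series of layers.\<close>

lemma eventually_le_twice_of_halving:
  fixes T V :: "nat \<Rightarrow> real"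
  assumes step: "\<forall>\<^sub>F n in sequentially. T n \<le> V n + T (Suc n)"
    and half: "\<forall>\<^sub>F n in sequentially. V (Suc n) \<le> V n / 2"
    and nn: "\<forall>\<^sub>F n in sequentially. 0 \<le> V n"
    and T0: "T \<longlonglongrightarrow> 0"
  shows "\<forall>\<^sub>F n in sequentially. T n \<le> 2 * V n"
proof -
  have "\<forall>\<^sub>F n in sequentially. T n \<le> V n + T (Suc n) \<and> V (Suc n) \<le> V n / 2 \<and> 0 \<le> V n"
    using step half nn by eventually_elim auto
  then obtain n0 where n0:
    "\<And>n. n0 \<le> n \<Longrightarrow> T n \<le> V n + T (Suc n) \<and> V (Suc n) \<le> V n / 2 \<and> 0 \<le> V n"
    unfolding eventually_sequentially by blast
  have "T n \<le> 2 * V n" if n: "n0 \<le> n" for n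
  proof -
    have telescope: "T n - 2 * V n \<le> T (n + k) - 2 * V (n + k)" for k
    proof (induction k)
      case (Suc k)
      then show ?case using n0[of "n + k"] n by simp
    qed simp
    have "T n - 2 * V n \<le> T (n + k)" for k
      using telescope[of k] n0[of "n + k"] n by simp
    moreover have "(\<lambda>k. T (n + k)) \<longlonglongrightarrow> 0"
      using LIMSEQ_ignore_initial_segment[OF T0, of n] by (simp add: add.commute)
    ultimately have "T n - 2 * V n \<le> 0" by (meson LIMSEQ_le_const)
    then show ?thesis by simp
  qed
  then show ?thesis unfolding eventually_sequentially by blast
qed

section \<open>Densities whose level sets are asymptotically multiples of a star-shaped set\<close>

text \<open>Common frame for both density classes: the heights \<open>c n\<close> fall faster than
  any geometric sequence, while consecutive radii \<open>r n\<close> have ratio tending to 1. For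
  \<open>f\<close> only measurability and nonnegativity are asked, because a homothetic density may
  vanish outside a cone.\<close>

locale level_sandwich =
  fixes D :: "'a::euclidean_space set" and f :: "'a \<Rightarrow> real" and c r :: "nat \<Rightarrow> real"
  assumes open_D: "open D" and bounded_D: "bounded D" and nonempty_D: "D \<noteq> {}"
    and star_D: "star_shaped D"
    and f_meas [measurable]: "f \<in> borel_measurable borel" and f_nonneg: "\<And>x. 0 \<le> f x"
    and prob_N: "prob_space (density lborel (\<lambda>x. ennreal (f x)))"
    and c_pos: "\<And>n. 0 < c n"
    and c_ratio: "(\<lambda>n. c (Suc n) / c n) \<longlonglongrightarrow> 0"
    and r_top: "filterlim r at_top sequentially"
    and r_ratio: "(\<lambda>n. r (Suc n) / r n) \<longlonglongrightarrow> 1"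
    and sandwich: "\<And>\<epsilon>. 0 < \<epsilon> \<Longrightarrow> \<forall>\<^sub>F n in sequentially.
      (*\<^sub>R) (exp (- \<epsilon>) * r n) ` D \<subseteq> {x. c n < f x} \<and> {x. c n < f x} \<subseteq> (*\<^sub>R) (exp \<epsilon> * r n) ` D"
begin

abbreviation N :: "'a measure" where "N \<equiv> density lborel (\<lambda>x. ennreal (f x))"

sublocale prob_space N by (rule prob_N)

lemma measure_N_le:
  assumes A [measurable]: "A \<in> sets borel" and "bounded A" "\<And>x. x \<in> A \<Longrightarrow> f x \<le> k" "0 \<le> k"
  shows "measure N A \<le> k * measure lborel A"
proof -
  have "emeasure N A = (\<integral>\<^sup>+x. ennreal (f x) * indicator A x \<partial>lborel)"
    by (subst emeasure_density) auto
  also have "\<dots> \<le> (\<integral>\<^sup>+x. ennreal k * indicator A x \<partial>lborel)"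
    using assms by (intro nn_integral_mono) (auto simp: indicator_def ennreal_leI)
  also have "\<dots> = ennreal k * emeasure lborel A"
    by (subst nn_integral_cmult_indicator) auto
  also have "emeasure lborel A = ennreal (measure lborel A)"
    using emeasure_bounded_finite[OF \<open>bounded A\<close>] by (intro emeasure_eq_ennreal_measure) auto
  finally have "ennreal (measure N A) \<le> ennreal (k * measure lborel A)"
    using assms(4) by (simp add: emeasure_eq_measure ennreal_mult)
  then show ?thesis using assms(4) by simp
qed

lemma measure_N_ge:
  assumes A [measurable]: "A \<in> sets borel" and B [measurable]: "B \<in> sets borel"
    and "bounded B" "B \<subseteq> A" "\<And>x. x \<in> B \<Longrightarrow> k \<le> f x" "0 \<le> k"
  shows "k * measure lborel B \<le> measure N A"
proof -
  have "emeasure lborel B = ennreal (measure lborel B)"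
    using emeasure_bounded_finite[OF \<open>bounded B\<close>] by (intro emeasure_eq_ennreal_measure) auto
  then have "ennreal (k * measure lborel B) = ennreal k * emeasure lborel B"
    using assms(6) by (simp add: ennreal_mult)
  also have "\<dots> = (\<integral>\<^sup>+x. ennreal k * indicator B x \<partial>lborel)"
    by (subst nn_integral_cmult_indicator) auto
  also have "\<dots> \<le> (\<integral>\<^sup>+x. ennreal (f x) * indicator A x \<partial>lborel)"
    using assms by (intro nn_integral_mono) (auto simp: indicator_def ennreal_leI)
  also have "\<dots> = emeasure N A"
    by (subst emeasure_density) auto
  finally show ?thesis by (simp add: emeasure_eq_measure)
qed

lemma r_eventually_ge: "\<forall>\<^sub>F n in sequentially. z \<le> r n"
  using r_top by (simp add: filterlim_at_top)

lemma r_eventually_pos: "\<forall>\<^sub>F n in sequentially. 0 < r n"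
  using r_eventually_ge[of 1] by eventually_elim simp

lemma r_step:
  assumes "1 < k"
  shows "\<forall>\<^sub>F n in sequentially. r (Suc n) \<le> k * r n"
  using order_tendstoD(2)[OF r_ratio assms] r_eventually_pos
  by eventually_elim (simp add: field_simps)

lemma c_step:
  assumes "0 < k"
  shows "\<forall>\<^sub>F n in sequentially. c (Suc n) \<le> k * c n"
  using order_tendstoD(2)[OF c_ratio assms]
proof eventually_elim
  case (elim n)
  then show ?case using c_pos[of n] by (simp add: field_simps)
qed

lemma c_tendsto_0: "c \<longlonglongrightarrow> 0"
proof -
  obtain n0 where "\<And>n. n0 \<le> n \<Longrightarrow> c (Suc n) \<le> 1/2 * c n"
    using c_step[of "1/2"] unfolding eventually_sequentially by auto
  then have "summable c"
    using c_pos by (intro summable_ratio_test[of "1/2" n0]) (auto simp: less_imp_le)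
  then show ?thesis by (rule summable_LIMSEQ_zero)
qed

text \<open>The zero set of \<open>f\<close> may have infinite Lebesgue measure but is null for
  \<open>N\<close>. Thus the distribution function of \<open>f\<close> under \<open>N\<close>
  vanishes at 0, and its right continuity there gives the limit along \<open>c\<close>.\<close>

lemma measure_sublevel_tendsto_0: "(\<lambda>n. measure N {x. f x \<le> c n}) \<longlonglongrightarrow> 0"
proof -
  interpret F: real_distribution "distr N borel f"
    by (rule real_distribution_distr) simp
  have cdf: "cdf (distr N borel f) z = measure N {x. f x \<le> z}" for z
    by (simp add: cdf_def2 measure_distr vimage_def)
  have "emeasure N {x. f x \<le> 0} = (\<integral>\<^sup>+x. ennreal (f x) * indicator {x. f x \<le> 0} x \<partial>lborel)"
    by (subst emeasure_density) auto
  also have "\<dots> = (\<integral>\<^sup>+x. 0 \<partial>(lborel :: 'a measure))"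
    by (intro nn_integral_cong) (auto simp: indicator_def ennreal_neg)
  finally have "cdf (distr N borel f) 0 = 0"
    by (simp add: cdf measure_def)
  then have "(cdf (distr N borel f) \<longlongrightarrow> 0) (at_right 0)"
    using F.cdf_is_right_cont[of 0] by (simp add: continuous_within)
  moreover have "filterlim c (at_right 0) sequentially"
    using c_tendsto_0 c_pos by (intro tendsto_imp_filterlim_at_right) auto
  ultimately have "(\<lambda>n. cdf (distr N borel f) (c n)) \<longlonglongrightarrow> 0"
    by (rule filterlim_compose)
  then show ?thesis by (simp add: cdf)
qed

lemma open_scaled_D: "0 < t \<Longrightarrow> open ((*\<^sub>R) t ` D)"
  using open_D by (simp add: open_scaling)

text \<open>The sublevel set is cut into layers between consecutive heights. Each layer has density
  at most \<open>c n\<close> and sits in a multiple of \<open>D\<close>; since \<open>c\<close>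
  decays rapidly and volumes grow slowly, the first layer dominates the sum.\<close>

lemma measure_sublevel_bound:
  "\<exists>C>0. \<forall>\<^sub>F n in sequentially. measure N {x. f x \<le> c n} \<le> C * c n * r n ^ DIM('a)"
proof -
  define T where "T n = measure N {x. f x \<le> c n}" for n
  define v where "v = measure lborel D"
  \<comment> \<open>Bound for the mass of one layer: \<open>c n\<close> caps the density, and the
    layer lies above height \<open>c (Suc n)\<close>, hence inside \<open>2 * r (Suc n)\<close>
    times \<open>D\<close>.\<close>
  define V where "V n = c n * ((2 * r (Suc n)) ^ DIM('a) * v)" for n
  have v: "0 < v"
    using measure_lborel_open_pos open_D bounded_D nonempty_D by (simp add: v_def)
  \<comment> \<open>The sandwich is applied with \<open>ln 2\<close>, so that its outer factor is
    2.\<close>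
  have "\<forall>\<^sub>F n in sequentially. {x. c n < f x} \<subseteq> (*\<^sub>R) (2 * r n) ` D"
    using sandwich[OF ln_gt_zero[of 2]] by (auto elim: eventually_mono)
  then have up: "\<forall>\<^sub>F n in sequentially. {x. c (Suc n) < f x} \<subseteq> (*\<^sub>R) (2 * r (Suc n)) ` D"
    by (rule eventually_sequentially_Suc[THEN iffD2])
  have pos: "\<forall>\<^sub>F n in sequentially. 0 < r (Suc n)"
    by (rule eventually_sequentially_Suc[THEN iffD2, OF r_eventually_pos])
  have "\<forall>\<^sub>F n in sequentially. T n \<le> V n + T (Suc n)"
    using up pos
  proof eventually_elim
    case (elim n)
    let ?A = "{x. c (Suc n) < f x \<and> f x \<le> c n}"
    have sub: "?A \<subseteq> (*\<^sub>R) (2 * r (Suc n)) ` D" using elim by auto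
    have bd: "bounded ((*\<^sub>R) (2 * r (Suc n)) ` D)" using bounded_D by (rule bounded_scaling)
    have "T n \<le> measure N (?A \<union> {x. f x \<le> c (Suc n)})"
      unfolding T_def by (intro finite_measure_mono) auto
    also have "\<dots> \<le> measure N ?A + T (Suc n)"
      unfolding T_def by (intro measure_Un_le) auto
    also have "measure N ?A \<le> c n * measure lborel ?A"
      using c_pos[of n] bounded_subset[OF bd sub] by (intro measure_N_le) auto
    also have "measure lborel ?A \<le> measure lborel ((*\<^sub>R) (2 * r (Suc n)) ` D)"
      using sub open_scaled_D[of "2 * r (Suc n)"] elim emeasure_bounded_finite[OF bd]
      by (intro measure_mono_fmeasurable) (auto simp: fmeasurable_def)
    also have "\<dots> = (2 * r (Suc n)) ^ DIM('a) * v"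
      unfolding v_def using elim by (intro measure_lborel_scale open_D) simp
    finally show ?case using c_pos[of n] by (simp add: V_def)
  qed
  moreover have "\<forall>\<^sub>F n in sequentially. V (Suc n) \<le> V n / 2"
  proof -
    have "\<forall>\<^sub>F n in sequentially. r (Suc (Suc n)) \<le> 2 * r (Suc n)"
      by (rule eventually_sequentially_Suc[THEN iffD2, OF r_step]) simp
    moreover have "\<forall>\<^sub>F n in sequentially. 0 < r (Suc (Suc n))"
      by (rule eventually_sequentially_Suc[THEN iffD2, OF pos])
    \<comment> \<open>The power of 2 pays for the possible doubling of the radius, the extra factor
      2 gives the halving.\<close>
    moreover have "\<forall>\<^sub>F n in sequentially. c (Suc n) \<le> 1 / (2 * 2 ^ DIM('a)) * c n"
      by (rule c_step) simp
    ultimately show ?thesis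
    proof eventually_elim
      case (elim n)
      have "(2 * r (Suc (Suc n))) ^ DIM('a) \<le> (2 * (2 * r (Suc n))) ^ DIM('a)"
        using elim by (intro power_mono) auto
      also have "\<dots> = 2 ^ DIM('a) * (2 * r (Suc n)) ^ DIM('a)"
        by (rule power_mult_distrib)
      finally have "V (Suc n) \<le> (1 / (2 * 2 ^ DIM('a)) * c n) * (2 ^ DIM('a) * (2 * r (Suc n)) ^ DIM('a) * v)"
        unfolding V_def using elim v c_pos[of n] by (intro mult_mono) auto
      then show ?case by (simp add: V_def)
    qed
  qed
  moreover have "\<forall>\<^sub>F n in sequentially. 0 \<le> V n"
    using pos by eventually_elim (use c_pos v in \<open>simp add: V_def less_imp_le\<close>)
  moreover have "T \<longlonglongrightarrow> 0"
    using measure_sublevel_tendsto_0 by (simp add: T_def[abs_def])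
  ultimately have "\<forall>\<^sub>F n in sequentially. T n \<le> 2 * V n"
    by (rule eventually_le_twice_of_halving)
  \<comment> \<open>Replacing \<open>r (Suc n)\<close> by \<open>2 * r n\<close> turns the base 2
    into 4.\<close>
  then have "\<forall>\<^sub>F n in sequentially. T n \<le> (2 * 4 ^ DIM('a) * v) * c n * r n ^ DIM('a)"
    using r_step[of 2, simplified] pos
  proof eventually_elim
    case (elim n)
    have "(2 * r (Suc n)) ^ DIM('a) \<le> (4 * r n) ^ DIM('a)"
      using elim by (intro power_mono) auto
    then have "2 * V n \<le> 2 * (c n * ((4 * r n) ^ DIM('a) * v))"
      unfolding V_def using c_pos[of n] v by (intro mult_left_mono mult_right_mono) auto
    then show ?case using elim by (simp add: power_mult_distrib mult_ac)
  qed
  then show ?thesis using v unfolding T_def by (intro exI[of _ "2 * 4 ^ DIM('a) * v"]) auto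
qed

text \<open>For large \<open>t\<close> there is an index \<open>n\<close> such that the complement
  has density at most \<open>c (Suc n)\<close>, while a piece of the half-space with volume of order
  \<open>t ^ DIM('a)\<close> has density above \<open>c n\<close>. The ratio of these heights tends
  to 0 and beats all constants.\<close>

lemma tail_negligible:
  assumes \<epsilon>: "0 < \<epsilon>" and \<eta>: "0 < \<eta>" and x0: "x0 \<in> D" "m < exp \<epsilon> * (a \<bullet> x0)"
  shows "\<forall>\<^sub>F t in at_top.
    measure N (- (*\<^sub>R) (exp (5 * \<epsilon>) * t) ` D) \<le> \<eta> * measure N {x. t * m < a \<bullet> x}"
proof -
  \<comment> \<open>Blown up by \<open>t\<close>, this is the piece of the half-space used for the
    lower bound; the slack \<open>exp \<epsilon>\<close> makes it contain a multiple of
    \<open>x0\<close>, so its volume is positive.\<close>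
  define W where "W = (*\<^sub>R) (exp \<epsilon>) ` D \<inter> {x. m < a \<bullet> x}"
  define \<kappa> where "\<kappa> = measure lborel W"
  have W: "open W" "bounded W"
    unfolding W_def using open_scaled_D bounded_D
    by (auto intro!: open_Int open_halfspace_gt bounded_Int bounded_scaling)
  have "exp \<epsilon> *\<^sub>R x0 \<in> W" using x0 by (auto simp: W_def)
  then have \<kappa>: "0 < \<kappa>" unfolding \<kappa>_def using W by (intro measure_lborel_open_pos) auto
  obtain C where C: "0 < C"
    and T: "\<forall>\<^sub>F n in sequentially. measure N {x. f x \<le> c n} \<le> C * c n * r n ^ DIM('a)"
    using measure_sublevel_bound by blast
  \<comment> \<open>Chosen so that all constants of the final estimate cancel and leave exactly
    \<open>\<eta>\<close>.\<close>
  define \<theta> where "\<theta> = \<eta> * \<kappa> / (C * exp (5 * \<epsilon>) ^ DIM('a))"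
  have \<theta>: "0 < \<theta>" using \<eta> \<kappa> C by (simp add: \<theta>_def)
  have "\<forall>\<^sub>F n in sequentially. measure N {x. f x \<le> c n} \<le> C * c n * r n ^ DIM('a)
      \<and> ((*\<^sub>R) (exp (- \<epsilon>) * r n) ` D \<subseteq> {x. c n < f x} \<and> {x. c n < f x} \<subseteq> (*\<^sub>R) (exp \<epsilon> * r n) ` D)
      \<and> r (Suc n) \<le> exp \<epsilon> * r n \<and> 0 < r n \<and> c (Suc n) \<le> \<theta> * c n"
    using T sandwich[OF \<epsilon>] r_step[of "exp \<epsilon>", unfolded one_less_exp_iff, OF \<epsilon>]
      r_eventually_pos c_step[OF \<theta>]
    by eventually_elim blast
  then obtain n0 where n0: "\<And>n. n0 \<le> n \<Longrightarrow>
      measure N {x. f x \<le> c n} \<le> C * c n * r n ^ DIM('a)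
      \<and> (*\<^sub>R) (exp (- \<epsilon>) * r n) ` D \<subseteq> {x. c n < f x} \<and> {x. c n < f x} \<subseteq> (*\<^sub>R) (exp \<epsilon> * r n) ` D
      \<and> r (Suc n) \<le> exp \<epsilon> * r n \<and> 0 < r n \<and> c (Suc n) \<le> \<theta> * c n"
    unfolding eventually_sequentially by auto
  have "measure N (- (*\<^sub>R) (exp (5 * \<epsilon>) * t) ` D) \<le> \<eta> * measure N {x. t * m < a \<bullet> x}"
    if t: "max 1 (r (Suc n0)) \<le> t" for t
  proof -
    have t0: "0 < t" using t by simp
    \<comment> \<open>Since \<open>r\<close> need not be monotone, the last index with a small
      radius is taken as the maximum of this finite set.\<close>
    define I where "I = {n. r n \<le> exp (4 * \<epsilon>) * t}"
    obtain n1 where "\<And>n. n1 \<le> n \<Longrightarrow> exp (4 * \<epsilon>) * t + 1 \<le> r n"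
      using r_eventually_ge unfolding eventually_sequentially by blast
    then have "n < n1" if "n \<in> I" for n using that by (force simp: I_def not_less[symmetric])
    then have "I \<subseteq> {..<n1}" by blast
    then have fin: "finite I" by (rule finite_subset) simp
    have "1 * t \<le> exp (4 * \<epsilon>) * t" using t0 \<epsilon> by (intro mult_right_mono) auto
    moreover have "r (Suc n0) \<le> 1 * t" using t by simp
    ultimately have mem: "Suc n0 \<in> I" unfolding I_def mem_Collect_eq by (rule order_trans[rotated])
    \<comment> \<open>Stepping back by one leaves two heights: \<open>c (Suc n)\<close> for the
      outer estimate and \<open>c n\<close> for the inner one.\<close>
    define n where "n = Max I - 1"
    have "Max I \<in> I" using fin mem by (intro Max_in) auto
    moreover have "Suc n0 \<le> Max I" using fin mem by simp
    ultimately have n: "n0 \<le> n" "Suc n \<in> I" and n_eq: "Suc n = Max I" by (auto simp: n_def)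
    have "Suc (Suc n) \<notin> I" using Max_ge[OF fin, of "Suc (Suc n)"] n_eq by auto
    \<comment> \<open>Of the exponent 4, two index steps use up 2 and the inner sandwich factor 1,
      which leaves the multiple \<open>exp \<epsilon> * t\<close> needed to cover the blown-up
      \<open>W\<close>.\<close>
    then have "exp (4 * \<epsilon>) * t < r (Suc (Suc n))" by (simp add: I_def)
    also have "\<dots> \<le> exp \<epsilon> * r (Suc n)" using n0[of "Suc n"] n by simp
    also have "\<dots> \<le> exp \<epsilon> * (exp \<epsilon> * r n)" using n0[of n] n by simp
    also have "\<dots> = exp (2 * \<epsilon>) * r n" by (simp add: exp_add[symmetric])
    also have "\<dots> = exp (3 * \<epsilon>) * (exp (- \<epsilon>) * r n)" by (simp add: exp_add[symmetric])
    also have "exp (4 * \<epsilon>) * t = exp (3 * \<epsilon>) * (exp \<epsilon> * t)" by (simp add: exp_add[symmetric])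
    finally have lower: "exp \<epsilon> * t \<le> exp (- \<epsilon>) * r n" by simp
    have rN: "r (Suc n) \<le> exp (4 * \<epsilon>) * t" "0 < r (Suc n)"
      using n n0[of "Suc n"] by (auto simp: I_def)
    have "exp \<epsilon> * r (Suc n) \<le> exp \<epsilon> * (exp (4 * \<epsilon>) * t)" using rN by simp
    also have "\<dots> = exp (5 * \<epsilon>) * t" by (simp add: exp_add[symmetric])
    finally have "(*\<^sub>R) (exp \<epsilon> * r (Suc n)) ` D \<subseteq> (*\<^sub>R) (exp (5 * \<epsilon>) * t) ` D"
      using rN by (intro star_shaped_scale_mono star_D) auto
    then have "{x. c (Suc n) < f x} \<subseteq> (*\<^sub>R) (exp (5 * \<epsilon>) * t) ` D"
      using n0[of "Suc n"] n by auto
    then have "- (*\<^sub>R) (exp (5 * \<epsilon>) * t) ` D \<subseteq> {x. f x \<le> c (Suc n)}"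
      by (auto simp: subset_iff not_less[symmetric])
    then have "measure N (- (*\<^sub>R) (exp (5 * \<epsilon>) * t) ` D) \<le> measure N {x. f x \<le> c (Suc n)}"
      by (rule finite_measure_mono) simp
    also have "\<dots> \<le> C * c (Suc n) * r (Suc n) ^ DIM('a)" using n0[of "Suc n"] n by simp
    also have "\<dots> \<le> C * (\<theta> * c n) * (exp (5 * \<epsilon>) * t) ^ DIM('a)"
    proof (intro mult_mono power_mono)
      have "exp (4 * \<epsilon>) * t \<le> exp (5 * \<epsilon>) * t" using \<epsilon> t0 by simp
      then show "r (Suc n) \<le> exp (5 * \<epsilon>) * t" using rN by simp
    qed (use n0[of n] n C \<theta> rN c_pos[of n] c_pos[of "Suc n"] in auto)
    also have "\<dots> = \<eta> * (c n * (t ^ DIM('a) * \<kappa>))"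
      using C by (simp add: \<theta>_def power_mult_distrib)
    also have "t ^ DIM('a) * \<kappa> = measure lborel ((*\<^sub>R) t ` W)"
      using W t0 by (simp add: \<kappa>_def measure_lborel_scale)
    also have "c n * measure lborel ((*\<^sub>R) t ` W) \<le> measure N {x. t * m < a \<bullet> x}"
    proof (rule measure_N_ge)
      show "(*\<^sub>R) t ` W \<in> sets borel" using W t0 by (intro borel_open) (simp add: open_scaling)
      show "bounded ((*\<^sub>R) t ` W)" using W by (simp add: bounded_scaling)
      show "(*\<^sub>R) t ` W \<subseteq> {x. t * m < a \<bullet> x}" using t0 by (auto simp: W_def)
      have "(*\<^sub>R) t ` W \<subseteq> (*\<^sub>R) (exp \<epsilon> * t) ` D" by (auto simp: W_def mult.commute)
      also have "\<dots> \<subseteq> (*\<^sub>R) (exp (- \<epsilon>) * r n) ` D"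
        using lower t0 by (intro star_shaped_scale_mono star_D) auto
      also have "\<dots> \<subseteq> {x. c n < f x}" using n0[of n] n by simp
      finally show "x \<in> (*\<^sub>R) t ` W \<Longrightarrow> c n \<le> f x" for x by force
    qed (use c_pos[of n] in auto)
    finally show ?thesis using \<eta> by simp
  qed
  then show ?thesis unfolding eventually_at_top_linorder by blast
qed

section \<open>Half-space tails and joint exceedances\<close>

text \<open>A fixed multiple of \<open>D\<close> eventually lies inside a level set, so
  \<open>f\<close> is bounded below by some \<open>c n\<close> on a non-empty open part of
  \<open>U\<close>.\<close>

lemma measure_open_pos:
  assumes "open U" "0 < t" "x \<in> (*\<^sub>R) t ` D" "x \<in> U"
  shows "0 < measure N U"
proof -
  have "\<forall>\<^sub>F n in sequentially. (*\<^sub>R) t ` D \<subseteq> {x. c n < f x}"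
    using sandwich[OF zero_less_one] r_eventually_ge[of "exp 1 * t"]
  proof eventually_elim
    case (elim n)
    have "exp (- 1) * (exp 1 * t) \<le> exp (- 1) * r n" using elim by (intro mult_left_mono) auto
    then have "t \<le> exp (- 1) * r n" by (simp add: mult.assoc[symmetric] exp_add[symmetric])
    then have "(*\<^sub>R) t ` D \<subseteq> (*\<^sub>R) (exp (- 1) * r n) ` D"
      using assms by (intro star_shaped_scale_mono star_D)
    then show ?case using elim by blast
  qed
  then obtain n where n: "(*\<^sub>R) t ` D \<subseteq> {x. c n < f x}"
    by (meson eventually_happens trivial_limit_sequentially)
  have W: "open (U \<inter> (*\<^sub>R) t ` D)" "bounded (U \<inter> (*\<^sub>R) t ` D)"
    using assms open_scaled_D bounded_D by (auto intro: bounded_scaling)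
  then have "0 < c n * measure lborel (U \<inter> (*\<^sub>R) t ` D)"
    using assms c_pos by (intro mult_pos_pos measure_lborel_open_pos) auto
  also have "\<dots> \<le> measure N U"
    using assms W n c_pos[of n] by (intro measure_N_ge) (auto simp: less_imp_le)
  finally show ?thesis .
qed


text \<open>Ensures that a small tail probability forces a large threshold. With support value 0,
  positivity is claimed only for negative thresholds.\<close>

lemma tail_pos:
  assumes approx: "\<And>z. z < \<alpha> \<Longrightarrow> \<exists>x\<in>D. z < a \<bullet> x"
    and "0 < \<alpha> \<or> \<alpha> = 0 \<and> z0 < 0"
  shows "0 < measure N {x. z0 < a \<bullet> x}"
proof -
  \<comment> \<open>For \<open>\<alpha> > 0\<close> the multiple is large enough to bring
    \<open>z0 / t\<close> below the support value.\<close>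
  define t where "t = (if 0 < \<alpha> then max 1 (z0 / \<alpha> + 1) else 1)"
  have t: "0 < t" by (simp add: t_def less_max_iff_disj)
  have "z0 / t < \<alpha>"
  proof (cases "0 < \<alpha>")
    case True
    then have "z0 / \<alpha> < t" by (simp add: t_def)
    then show ?thesis using True t by (simp add: field_simps)
  qed (use assms(2) in \<open>auto simp: t_def\<close>)
  then obtain x where x: "x \<in> D" "z0 / t < a \<bullet> x" using approx by blast
  show ?thesis
  proof (rule measure_open_pos)
    show "open {x. z0 < a \<bullet> x}" by (rule open_halfspace_gt)
    show "t *\<^sub>R x \<in> (*\<^sub>R) t ` D" using x by blast
    show "t *\<^sub>R x \<in> {x. z0 < a \<bullet> x}" using x t by (simp add: field_simps)
  qed (rule t)
qed

text \<open>The slack \<open>- 1\<close> in the second threshold covers the direction in which \<open>D\<close> has support value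
  \<open>0\<close>; there the quantiles tend to \<open>0\<close> from below instead of to infinity.\<close>

lemma joint_tail_negligible:
  assumes approx: "\<And>z. z < \<alpha> \<Longrightarrow> \<exists>x\<in>D. z < a \<bullet> x"
    and pos: "0 < \<alpha>" "0 \<le> \<beta>" "0 < \<delta>" "0 < \<eta>"
    and gap: "\<And>x. x \<in> D \<Longrightarrow> a \<bullet> x \<le> \<alpha> - \<delta> \<or> b \<bullet> x \<le> \<beta> - \<delta>"
  shows "\<forall>\<^sub>F t in at_top. \<forall>y\<ge>t * \<beta> - 1.
    measure N {z. t * \<alpha> < a \<bullet> z \<and> y < b \<bullet> z} \<le> \<eta> * measure N {z. t * \<alpha> < a \<bullet> z}"
proof -
  \<comment> \<open>This makes \<open>5 * \<epsilon> * (\<alpha> + \<beta> + 1)\<close> equal to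
    half the gap \<open>\<delta>\<close>.\<close>
  define \<epsilon> where "\<epsilon> = \<delta> / (10 * (\<alpha> + \<beta> + 1))"
  have \<epsilon>: "0 < \<epsilon>" using pos by (simp add: \<epsilon>_def)
  have "\<alpha> * exp (- \<epsilon>) < \<alpha> * 1" using pos \<epsilon> by (intro mult_strict_left_mono) auto
  then obtain x0 where x0: "x0 \<in> D" "\<alpha> * exp (- \<epsilon>) < a \<bullet> x0" using approx by auto
  then have "\<alpha> < exp \<epsilon> * (a \<bullet> x0)" by (simp add: exp_minus field_simps)
  then have "\<forall>\<^sub>F t in at_top.
      measure N (- (*\<^sub>R) (exp (5 * \<epsilon>) * t) ` D) \<le> \<eta> * measure N {x. t * \<alpha> < a \<bullet> x}"
    by (rule tail_negligible[OF \<epsilon> pos(4) x0(1)])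
  \<comment> \<open>Beyond \<open>2 / \<delta>\<close> the slack 1 in the second threshold, divided
    by \<open>t\<close>, costs at most the other half of the gap.\<close>
  moreover have "\<forall>\<^sub>F t in at_top. max 1 (2 / \<delta>) \<le> t" by (rule eventually_ge_at_top)
  ultimately show ?thesis
  proof eventually_elim
    case (elim t)
    have t: "0 < t" "1 / t \<le> \<delta> / 2" using elim pos by (auto simp: field_simps)
    define p where "p = exp (- (5 * \<epsilon>))"
    have p: "0 < p" "p \<le> 1" "1 - 5 * \<epsilon> \<le> p"
      using \<epsilon> exp_ge_add_one_self[of "- (5 * \<epsilon>)"] by (auto simp: p_def)
    have shrink: "m - \<delta> / 2 \<le> p * m" if "0 \<le> m" "m \<le> \<alpha> + \<beta> + 1" for m
    proof -
      have "5 * \<epsilon> * m \<le> 5 * \<epsilon> * (\<alpha> + \<beta> + 1)" using that \<epsilon> by (intro mult_left_mono) auto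
      also have "\<dots> = \<delta> / 2" using pos by (simp add: \<epsilon>_def field_simps)
      finally have "m - \<delta> / 2 \<le> (1 - 5 * \<epsilon>) * m" by (simp add: algebra_simps)
      also have "\<dots> \<le> p * m" using p that by (intro mult_right_mono) auto
      finally show ?thesis .
    qed
    \<comment> \<open>Scaled back into \<open>D\<close> by \<open>p / t\<close>, such a point would
      exceed \<open>\<alpha> - \<delta>\<close> in direction \<open>a\<close> and
      \<open>\<beta> - \<delta>\<close> in direction \<open>b\<close>, against
      \<open>gap\<close>.\<close>
    have disj: "z \<notin> (*\<^sub>R) (exp (5 * \<epsilon>) * t) ` D" if z: "t * \<alpha> < a \<bullet> z" "t * \<beta> - 1 < b \<bullet> z" for z
    proof
      assume "z \<in> (*\<^sub>R) (exp (5 * \<epsilon>) * t) ` D"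
      then have "(p / t) *\<^sub>R z \<in> D"
        using t by (simp add: mem_scaleR_image_iff p_def exp_minus field_simps)
      then have "p / t * (a \<bullet> z) \<le> \<alpha> - \<delta> \<or> p / t * (b \<bullet> z) \<le> \<beta> - \<delta>"
        using gap by fastforce
      moreover have "p / t * (t * \<alpha>) < p / t * (a \<bullet> z)"
        using z t p by (intro mult_strict_left_mono) auto
      then have "p * \<alpha> < p / t * (a \<bullet> z)" using t by simp
      moreover have "p / t * (t * \<beta> - 1) < p / t * (b \<bullet> z)"
        using z t p by (intro mult_strict_left_mono) auto
      then have "p * \<beta> - p * (1 / t) < p / t * (b \<bullet> z)" using t by (simp add: field_simps)
      moreover have "p * (1 / t) \<le> 1 * (\<delta> / 2)"
        using p t pos by (intro mult_mono) auto
      ultimately show False using shrink[of \<alpha>] shrink[of \<beta>] pos by linarith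
    qed
    have "measure N {z. t * \<alpha> < a \<bullet> z \<and> y < b \<bullet> z} \<le> measure N (- (*\<^sub>R) (exp (5 * \<epsilon>) * t) ` D)"
      if "t * \<beta> - 1 \<le> y" for y
    proof (rule finite_measure_mono)
      show "{z. t * \<alpha> < a \<bullet> z \<and> y < b \<bullet> z} \<subseteq> - (*\<^sub>R) (exp (5 * \<epsilon>) * t) ` D"
        using disj that by force
      show "- (*\<^sub>R) (exp (5 * \<epsilon>) * t) ` D \<in> events"
        using open_scaled_D[of "exp (5 * \<epsilon>) * t"] t by (simp add: borel_comp borel_open)
    qed
    then show ?case using elim by force
  qed
qed

text \<open>Small \<open>s\<close> makes both thresholds large, or above -1 where the support value
  is 0. The direction with the smaller threshold relative to its support value then serves as
  reference, and the joint event is negligible against its tail, which is \<open>s\<close>.\<close>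

lemma joint_exceedance_small:
  assumes approx_a: "\<And>z. z < \<alpha> \<Longrightarrow> \<exists>x\<in>D. z < a \<bullet> x"
    and approx_b: "\<And>z. z < \<beta> \<Longrightarrow> \<exists>x\<in>D. z < b \<bullet> x"
    and pos: "0 \<le> \<alpha>" "0 \<le> \<beta>" "0 < \<delta>" "0 < \<eta>"
    and gap: "\<And>x. x \<in> D \<Longrightarrow> a \<bullet> x \<le> \<alpha> - \<delta> \<or> b \<bullet> x \<le> \<beta> - \<delta>"
  shows "\<exists>s0>0. \<forall>s x y. 0 < s \<longrightarrow> s < s0 \<longrightarrow>
    measure N {z. x < a \<bullet> z} = s \<longrightarrow> measure N {z. y < b \<bullet> z} = s \<longrightarrow>
    measure N {z. x < a \<bullet> z \<and> y < b \<bullet> z} \<le> \<eta> * s"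
proof -
  \<comment> \<open>If both support values were 0, points of \<open>D\<close> near the origin would
    come within \<open>\<delta>\<close> of both, against \<open>gap\<close>.\<close>
  have not_both_0: "0 < \<alpha> \<or> 0 < \<beta>"
  proof (rule ccontr)
    assume "\<not> (0 < \<alpha> \<or> 0 < \<beta>)"
    then have "\<alpha> = 0" "\<beta> = 0" using pos by auto
    have "open ({x. - \<delta> < a \<bullet> x} \<inter> {x. - \<delta> < b \<bullet> x})"
      by (intro open_Int open_halfspace_gt)
    moreover have "0 \<in> closure D \<inter> ({x. - \<delta> < a \<bullet> x} \<inter> {x. - \<delta> < b \<bullet> x})"
      using pos zero_in_closure_star_shaped[OF star_D nonempty_D] by simp
    ultimately obtain x where "x \<in> D" "- \<delta> < a \<bullet> x" "- \<delta> < b \<bullet> x"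
      using open_Int_closure_eq_empty[of "{x. - \<delta> < a \<bullet> x} \<inter> {x. - \<delta> < b \<bullet> x}" D] by blast
    then show False using gap[of x] \<open>\<alpha> = 0\<close> \<open>\<beta> = 0\<close> by auto
  qed
  have "\<exists>R. \<forall>t\<ge>R. 0 < \<alpha> \<longrightarrow> (\<forall>y\<ge>t * \<beta> - 1.
      measure N {z. t * \<alpha> < a \<bullet> z \<and> y < b \<bullet> z} \<le> \<eta> * measure N {z. t * \<alpha> < a \<bullet> z})"
    using joint_tail_negligible[OF approx_a _ pos(2,3,4) gap] unfolding eventually_at_top_linorder
    by blast
  then obtain R where R: "\<And>t y. R \<le> t \<Longrightarrow> 0 < \<alpha> \<Longrightarrow> t * \<beta> - 1 \<le> y \<Longrightarrow>
      measure N {z. t * \<alpha> < a \<bullet> z \<and> y < b \<bullet> z} \<le> \<eta> * measure N {z. t * \<alpha> < a \<bullet> z}"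
    by blast
  have gap': "b \<bullet> x \<le> \<beta> - \<delta> \<or> a \<bullet> x \<le> \<alpha> - \<delta>" if "x \<in> D" for x
    using gap[OF that] by blast
  have "\<exists>R. \<forall>t\<ge>R. 0 < \<beta> \<longrightarrow> (\<forall>y\<ge>t * \<alpha> - 1.
      measure N {z. t * \<beta> < b \<bullet> z \<and> y < a \<bullet> z} \<le> \<eta> * measure N {z. t * \<beta> < b \<bullet> z})"
    using joint_tail_negligible[OF approx_b _ pos(1,3,4) gap'] unfolding eventually_at_top_linorder
    by blast
  then obtain R' where R': "\<And>t y. R' \<le> t \<Longrightarrow> 0 < \<beta> \<Longrightarrow> t * \<alpha> - 1 \<le> y \<Longrightarrow>
      measure N {z. t * \<beta> < b \<bullet> z \<and> y < a \<bullet> z} \<le> \<eta> * measure N {z. t * \<beta> < b \<bullet> z}"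
    by blast
  \<comment> \<open>The value -1 matches the slack in the second threshold and is the bound that a
    direction of support value 0 has to obey.\<close>
  define xa where "xa = (if 0 < \<alpha> then R * \<alpha> else - 1)"
  define yb where "yb = (if 0 < \<beta> then R' * \<beta> else - 1)"
  define s0 where "s0 = min (measure N {z. xa < a \<bullet> z}) (measure N {z. yb < b \<bullet> z})"
  have "0 < s0"
    unfolding s0_def xa_def yb_def using pos tail_pos[OF approx_a] tail_pos[OF approx_b] by simp
  moreover have "measure N {z. x < a \<bullet> z \<and> y < b \<bullet> z} \<le> \<eta> * s"
    if s: "s < s0" "measure N {z. x < a \<bullet> z} = s" "measure N {z. y < b \<bullet> z} = s" for s x y
  proof -
    have x: "xa < x"
    proof (rule ccontr)
      assume "\<not> xa < x"
      then have "measure N {z. xa < a \<bullet> z} \<le> measure N {z. x < a \<bullet> z}"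
        by (intro finite_measure_mono) auto
      then show False using s by (simp add: s0_def)
    qed
    have y: "yb < y"
    proof (rule ccontr)
      assume "\<not> yb < y"
      then have "measure N {z. yb < b \<bullet> z} \<le> measure N {z. y < b \<bullet> z}"
        by (intro finite_measure_mono) auto
      then show False using s by (simp add: s0_def)
    qed
    consider (a) "0 < \<alpha>" "x / \<alpha> * \<beta> - 1 \<le> y" | (b) "0 < \<beta>" "y / \<beta> * \<alpha> - 1 \<le> x"
    proof (cases "0 < \<alpha> \<and> 0 < \<beta>")
      case True
      then show ?thesis
      proof (cases "x / \<alpha> \<le> y / \<beta>")
        case le: True
        then have "x / \<alpha> * \<beta> \<le> y / \<beta> * \<beta>" using True by (intro mult_right_mono) auto
        then show ?thesis using True a by simp
      next
        case False
        then have "y / \<beta> * \<alpha> \<le> x / \<alpha> * \<alpha>" using True by (intro mult_right_mono) auto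
        then show ?thesis using True b by simp
      qed
    next
      case False
      then have "\<beta> = 0 \<or> \<alpha> = 0" using pos by auto
      then show ?thesis using not_both_0 x y a b by (auto simp: xa_def yb_def)
    qed
    then show ?thesis
    proof cases
      case a
      then show ?thesis using R[of "x / \<alpha>" y] x s by (simp add: xa_def field_simps)
    next
      case b
      have "{z. y < b \<bullet> z \<and> x < a \<bullet> z} = {z. x < a \<bullet> z \<and> y < b \<bullet> z}" by blast
      then show ?thesis using b R'[of "y / \<beta>" x] y s by (simp add: yb_def field_simps)
    qed
  qed
  ultimately show ?thesis by blast
qed

end

section \<open>Both density classes satisfy the level set sandwich\<close>

lemma prob_space_prob_density:
  assumes "prob_density f"
  shows "prob_space (density lborel (\<lambda>x. ennreal (f x)))"
  using assms unfolding prob_density_def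
  by (intro prob_spaceI) (simp add: emeasure_density)

lemma class_A_level_sandwich:
  assumes "D \<in> class_D" "f \<in> class_A D"
  shows "\<exists>c r. level_sandwich D f c r"
proof -
  obtain c r where "\<forall>n. 0 < c n" "filterlim r at_top sequentially"
    "(\<lambda>n. c (Suc n) / c n) \<longlonglongrightarrow> 0" "(\<lambda>n. r (Suc n) / r n) \<longlonglongrightarrow> 1"
    "\<forall>\<epsilon>>0. \<forall>\<^sub>F n in sequentially.
            (*\<^sub>R) (exp (- \<epsilon>) * r n) ` D \<subseteq> {x. c n < f x} \<and>
            {x. c n < f x} \<subseteq> (*\<^sub>R) (exp \<epsilon> * r n) ` D"
    using assms(2) unfolding class_A_def by blast
  moreover have "prob_density f" using assms(2) by (simp add: class_A_def)
  ultimately have "level_sandwich D f c r"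
    using assms(1) prob_space_prob_density[of f]
    by (intro level_sandwich.intro) (auto simp: class_D_def prob_density_def)
  then show ?thesis by blast
qed

lemma gauge_fn_nonneg:
  assumes "x \<in> cone_of D"
  shows "0 \<le> gauge_fn D x"
proof -
  obtain n where "0 < n" "x \<in> (*\<^sub>R) (real n) ` D" using assms by (auto simp: cone_of_def)
  then have "{t. 0 < t \<and> x \<in> (*\<^sub>R) t ` D} \<noteq> {}"
    using of_nat_0_less_iff[of n, where 'a=real] by blast
  then show ?thesis unfolding gauge_fn_def by (rule cInf_greatest) simp
qed

text \<open>An infimum below \<open>t\<close> is witnessed by a smaller scale, and star-shapedness
  enlarges it to \<open>t\<close>. Conversely, openness of \<open>D\<close> lets \<open>t\<close>
  shrink a little, which makes the inequality strict.\<close>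

lemma gauge_fn_less_iff:
  fixes D :: "'a::real_normed_vector set"
  assumes "open D" "star_shaped D" "0 < t"
  shows "x \<in> cone_of D \<and> gauge_fn D x < t \<longleftrightarrow> x \<in> (*\<^sub>R) t ` D"
proof
  assume x: "x \<in> cone_of D \<and> gauge_fn D x < t"
  then obtain n where "0 < n" "x \<in> (*\<^sub>R) (real n) ` D" by (auto simp: cone_of_def)
  then have "{t. 0 < t \<and> x \<in> (*\<^sub>R) t ` D} \<noteq> {}"
    using of_nat_0_less_iff[of n, where 'a=real] by blast
  then obtain s where "0 < s" "x \<in> (*\<^sub>R) s ` D" "s < t"
    using cInf_lessD[of "{t. 0 < t \<and> x \<in> (*\<^sub>R) t ` D}" t] x by (auto simp: gauge_fn_def)
  then show "x \<in> (*\<^sub>R) t ` D" using star_shaped_scale_mono[of D s t] assms by auto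
next
  assume x: "x \<in> (*\<^sub>R) t ` D"
  obtain n where n: "t \<le> real n" using real_arch_simple by blast
  then have "x \<in> (*\<^sub>R) (real n) ` D" using star_shaped_scale_mono[OF assms(2,3) n] x by blast
  moreover have "0 < n" using n assms(3) by (intro gr0I) simp
  ultimately have cone: "x \<in> cone_of D" unfolding cone_of_def by blast
  have "((\<lambda>s. (1 / s) *\<^sub>R x) \<longlongrightarrow> (1 / t) *\<^sub>R x) (at_left t)"
    using assms(3) by (intro tendsto_intros) auto
  moreover have "(1 / t) *\<^sub>R x \<in> D" using x assms(3) by (simp add: mem_scaleR_image_iff)
  ultimately have "\<forall>\<^sub>F s in at_left t. (1 / s) *\<^sub>R x \<in> D"
    by (rule topological_tendstoD[OF _ assms(1)])
  moreover have "\<forall>\<^sub>F s in at_left t. 0 < s \<and> s < t"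
    using eventually_at_left_real[OF assms(3)] by eventually_elim simp
  ultimately have "\<forall>\<^sub>F s in at_left t. (1 / s) *\<^sub>R x \<in> D \<and> 0 < s \<and> s < t"
    by (rule eventually_conj)
  then obtain s where s: "(1 / s) *\<^sub>R x \<in> D" "0 < s" "s < t"
    using eventually_happens'[OF trivial_limit_at_left_real] by blast
  then have "gauge_fn D x \<le> s" unfolding gauge_fn_def
    by (intro cInf_lower bdd_belowI[of _ 0]) (auto simp: mem_scaleR_image_iff)
  then show "x \<in> cone_of D \<and> gauge_fn D x < t" using s cone by simp
qed

text \<open>With heights \<open>f0 (r n)\<close> the level sets are exactly the multiples
  \<open>r n\<close> of \<open>D\<close>, because \<open>f0\<close> is strictly decreasing.
  Divergence of \<open>r\<close> is not part of the definition and has to be derived.\<close>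

lemma light_tailed_level_sandwich:
  assumes D: "D \<in> class_D" and "f \<in> class_H D" "light_tailed D f"
  shows "\<exists>c r. level_sandwich D f c r"
proof -
  have D': "open D" "bounded D" "D \<noteq> {}" "star_shaped D" using D by (auto simp: class_D_def)
  obtain f0 r where gen: "is_generator D f f0" and cont: "continuous_on {0..} f0"
    and f0_pos: "\<And>t. 0 \<le> t \<Longrightarrow> 0 < f0 t" and anti: "strict_antimono_on {0..} f0"
    and r_pos: "\<And>n. 0 < r n" and r_mono: "strict_mono r"
    and r_ratio: "(\<lambda>n. r (Suc n) / r n) \<longlonglongrightarrow> 1"
    and f0_ratio: "filterlim (\<lambda>n. f0 (r n) / f0 (r (Suc n))) at_top sequentially"
    using assms(3) unfolding light_tailed_def light_tailed_generator_def by blast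
  have f0_less: "f0 t < f0 s \<longleftrightarrow> s < t" if "0 \<le> s" "0 \<le> t" for s t
    using anti that unfolding monotone_on_def by (metis atLeast_iff less_asym linorder_neqE)
  have level: "{x. f0 (r n) < f x} = (*\<^sub>R) (r n) ` D" for n
  proof -
    have "f0 (r n) < f x \<longleftrightarrow> x \<in> cone_of D \<and> gauge_fn D x < r n" for x
    proof (cases "x \<in> cone_of D")
      case True
      then have "f x = f0 (gauge_fn D x)" using gen by (simp add: is_generator_def)
      then show ?thesis using True f0_less[of "gauge_fn D x" "r n"] gauge_fn_nonneg[OF True] r_pos[of n]
        by simp
    next
      case False
      then have "f x = 0" using gen by (simp add: is_generator_def)
      then show ?thesis using False f0_pos[of "r n"] r_pos[of n] by simp
    qed
    then show ?thesis using gauge_fn_less_iff[OF D'(1,4) r_pos] by blast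
  qed
  \<comment> \<open>Otherwise the increasing \<open>r\<close> has a finite limit
    \<open>l > 0\<close>, and continuity of \<open>f0\<close> at \<open>l\<close> makes the ratios
    tend to 1 instead of infinity.\<close>
  have r_top: "filterlim r at_top sequentially"
  proof (rule ccontr)
    assume not_top: "\<not> filterlim r at_top sequentially"
    have inc: "incseq r" using r_mono by (rule strict_mono_mono)
    obtain B where B: "\<And>n. r n \<le> B"
    proof -
      obtain Z where "\<not> (\<forall>\<^sub>F n in sequentially. Z \<le> r n)"
        using not_top by (auto simp: filterlim_at_top)
      then have "\<And>n. \<exists>k\<ge>n. r k < Z" unfolding eventually_sequentially by (meson not_le)
      then have "r n \<le> Z" for n using inc by (meson incseqD less_imp_le order_trans)
      then show ?thesis using that by blast
    qed
    obtain l where l: "r \<longlonglongrightarrow> l" using incseq_convergent[OF inc] B by blast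
    have "r 0 \<le> l" using incseq_le[OF inc l] .
    then have l_pos: "0 < l" using r_pos[of 0] by simp
    then have isCont: "isCont f0 l"
      using continuous_on_interior[OF cont] by simp
    have "(\<lambda>n. f0 (r n) / f0 (r (Suc n))) \<longlonglongrightarrow> f0 l / f0 l"
      using isCont_tendsto_compose[OF isCont l] isCont_tendsto_compose[OF isCont LIMSEQ_Suc[OF l]]
        f0_pos[of l] l_pos by (intro tendsto_divide) auto
    then show False
      using not_tendsto_and_filterlim_at_infinity[OF sequentially_bot]
        filterlim_at_top_imp_at_infinity[OF f0_ratio] by blast
  qed
  have "level_sandwich D f (\<lambda>n. f0 (r n)) r"
  proof (rule level_sandwich.intro)
    have f: "prob_density f" using assms(2) by (simp add: class_H_def)
    then show "f \<in> borel_measurable borel" "\<And>x. 0 \<le> f x" by (auto simp: prob_density_def)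
    show "prob_space (density lborel (\<lambda>x. ennreal (f x)))"
      using f by (rule prob_space_prob_density)
    show "0 < f0 (r n)" for n using r_pos[of n] f0_pos by simp
    show "(\<lambda>n. f0 (r (Suc n)) / f0 (r n)) \<longlonglongrightarrow> 0"
      using tendsto_inverse_0_at_top[OF f0_ratio] by (simp add: inverse_eq_divide)
    show "\<forall>\<^sub>F n in sequentially. (*\<^sub>R) (exp (- \<epsilon>) * r n) ` D \<subseteq> {x. f0 (r n) < f x} \<and>
        {x. f0 (r n) < f x} \<subseteq> (*\<^sub>R) (exp \<epsilon> * r n) ` D" if "0 < \<epsilon>" for \<epsilon>
    proof (intro always_eventually allI conjI)
      fix n
      have "exp (- \<epsilon>) * r n \<le> r n" "r n \<le> exp \<epsilon> * r n" using that r_pos[of n] by auto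
      then show "(*\<^sub>R) (exp (- \<epsilon>) * r n) ` D \<subseteq> {x. f0 (r n) < f x}"
        "{x. f0 (r n) < f x} \<subseteq> (*\<^sub>R) (exp \<epsilon> * r n) ` D"
        unfolding level using r_pos[of n] by (intro star_shaped_scale_mono D'(4); simp)+
    qed
  qed (use D' r_top r_ratio in auto)
  then show ?thesis by blast
qed

section \<open>Supporting hyperplanes of a set with smooth boundary\<close>

text \<open>A point of the closure that is extremal in both directions lies on two distinct supporting
  hyperplanes, which smoothness forbids; compactness makes the separation of the contact faces
  uniform.\<close>

lemma contact_faces_separated:
  fixes D :: "(real ^ 'd) set"
  assumes "open D" "bounded D" "D \<noteq> {}" "smooth_boundary D"
    and "norm a = 1" "norm b = 1" "a \<noteq> b"
    and le: "\<And>x. x \<in> D \<Longrightarrow> a \<bullet> x \<le> \<alpha>" "\<And>x. x \<in> D \<Longrightarrow> b \<bullet> x \<le> \<beta>"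
  shows "\<exists>\<delta>>0. \<forall>x\<in>D. a \<bullet> x \<le> \<alpha> - \<delta> \<or> b \<bullet> x \<le> \<beta> - \<delta>"
proof -
  \<comment> \<open>A step of length \<open>e\<close> along \<open>u\<close> stays in the open set
    \<open>D\<close> and raises the functional by \<open>e\<close>, so its bound is never attained
    in \<open>D\<close>.\<close>
  have strict: "u \<bullet> x < m" if u: "norm u = 1" "\<And>x. x \<in> D \<Longrightarrow> u \<bullet> x \<le> m" and x: "x \<in> D" for u m x
  proof -
    obtain e where e: "0 < e" "cball x e \<subseteq> D"
      using \<open>open D\<close> x open_contains_cball by blast
    then have "x + e *\<^sub>R u \<in> D" using u by (auto simp: dist_norm subset_iff)
    then have "u \<bullet> x + e * (u \<bullet> u) \<le> m" using u(2) by (force simp: inner_add_right)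
    then show ?thesis using e u by (simp add: norm_eq_1)
  qed
  have cl_le: "a \<bullet> p \<le> \<alpha>" "b \<bullet> p \<le> \<beta>" if "p \<in> closure D" for p
    using inner_le_on_closure[OF le(1) that] inner_le_on_closure[OF le(2) that] by auto
  have not_both: "\<not> (a \<bullet> p = \<alpha> \<and> b \<bullet> p = \<beta>)" if p: "p \<in> closure D" for p
  proof
    assume "a \<bullet> p = \<alpha> \<and> b \<bullet> p = \<beta>"
    then have eq: "a \<bullet> p = \<alpha>" "b \<bullet> p = \<beta>" by auto
    have "p \<notin> D" using strict[of a \<alpha> p] le assms eq by auto
    then have "p \<in> frontier D" using p \<open>open D\<close> by (simp add: frontier_def interior_open)
    then have unique: "\<exists>!H. hyperplane H \<and> p \<in> H \<and> H \<inter> D = {}"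
      using assms(4) by (simp add: smooth_boundary_def)
    have "hyperplane {x. a \<bullet> x = \<alpha>}" "hyperplane {x. b \<bullet> x = \<beta>}"
      using assms(5,6) unfolding hyperplane_def by (metis norm_zero zero_neq_one)+
    moreover have "{x. a \<bullet> x = \<alpha>} \<inter> D = {}" "{x. b \<bullet> x = \<beta>} \<inter> D = {}"
      using strict[OF assms(5) le(1)] strict[OF assms(6) le(2)] by (blast dest: less_imp_neq)+
    moreover have "p \<in> {x. a \<bullet> x = \<alpha>}" "p \<in> {x. b \<bullet> x = \<beta>}" using eq by auto
    ultimately have same: "{x. a \<bullet> x = \<alpha>} = {x. b \<bullet> x = \<beta>}" using unique by blast
    \<comment> \<open>The component of \<open>b\<close> orthogonal to \<open>a\<close>: moving by
      \<open>w\<close> stays on the common hyperplane, so \<open>b\<close> is orthogonal to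
      \<open>w\<close> as well, which forces \<open>w = 0\<close>.\<close>
    define w where "w = b - (a \<bullet> b) *\<^sub>R a"
    have aa: "a \<bullet> a = 1" "b \<bullet> b = 1" using assms by (auto simp: norm_eq_1)
    have "a \<bullet> (p + w) = \<alpha>"
      by (simp add: w_def inner_add_right inner_diff_right aa eq)
    then have "b \<bullet> (p + w) = \<beta>" using same by blast
    then have "b \<bullet> w = 0" by (simp add: inner_add_right eq)
    then have sq: "(a \<bullet> b) * (a \<bullet> b) = 1"
      by (simp add: w_def inner_diff_right aa inner_commute)
    have "w \<bullet> w = 1 - (a \<bullet> b) * (a \<bullet> b)"
      by (simp add: w_def inner_diff_left inner_diff_right aa inner_commute)
    then have "w = 0" using sq by simp
    then have b: "b = (a \<bullet> b) *\<^sub>R a" by (simp add: w_def)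
    have "a \<bullet> b = 1 \<or> a \<bullet> b = -1" using sq by (simp add: square_eq_1_iff)
    \<comment> \<open>In the opposite case the two strict bounds would squeeze
      \<open>a \<bullet> x\<close> strictly above and strictly below \<open>a \<bullet> p\<close>
      for any \<open>x\<close> in \<open>D\<close>.\<close>
    then have ba: "b = - a" using b \<open>a \<noteq> b\<close> by (metis scaleR_minus1_left scaleR_one)
    obtain x where "x \<in> D" using assms(3) by blast
    then have "a \<bullet> x < \<alpha>" "b \<bullet> x < \<beta>" using strict[of a \<alpha> x] strict[of b \<beta> x] le assms by auto
    then show False using eq ba by simp
  qed
  have "compact (closure D)" using assms(2) by (simp add: compact_closure)
  moreover have "continuous_on (closure D) (\<lambda>p. max (\<alpha> - a \<bullet> p) (\<beta> - b \<bullet> p))"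
    by (intro continuous_intros)
  ultimately obtain p where p: "p \<in> closure D"
    and inf: "\<And>x. x \<in> closure D \<Longrightarrow> max (\<alpha> - a \<bullet> p) (\<beta> - b \<bullet> p) \<le> max (\<alpha> - a \<bullet> x) (\<beta> - b \<bullet> x)"
    using continuous_attains_inf[of "closure D" "\<lambda>p. max (\<alpha> - a \<bullet> p) (\<beta> - b \<bullet> p)"] assms(3)
    by auto
  define \<delta> where "\<delta> = max (\<alpha> - a \<bullet> p) (\<beta> - b \<bullet> p)"
  have "0 < \<delta>" using not_both[OF p] cl_le[OF p] by (auto simp: \<delta>_def less_max_iff_disj)
  moreover have "a \<bullet> x \<le> \<alpha> - \<delta> \<or> b \<bullet> x \<le> \<beta> - \<delta>" if "x \<in> D" for x
    using inf[of x] that closure_subset[of D] unfolding \<delta>_def[symmetric] by (auto simp: le_max_iff_disj)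
  ultimately show ?thesis by blast
qed

section \<open>Exceedance functions and a criterion for asymptotic independence\<close>

text \<open>Between two points with equal distribution function \<open>X\<close> has no mass. The
  event \<open>B\<close> stands for an exceedance of the other variable, so this is the
  well-definedness of \<open>P\<close> in one argument.\<close>

lemma (in prob_space) prob_exceed_cong:
  assumes X [measurable]: "X \<in> borel_measurable M" and B [measurable]: "B \<in> events"
    and eq: "cdf (distr M borel X) x = cdf (distr M borel X) x'"
  shows "prob {\<omega> \<in> B. x < X \<omega>} = prob {\<omega> \<in> B. x' < X \<omega>}"
proof -
  have le: "prob {\<omega> \<in> B. x < X \<omega>} = prob {\<omega> \<in> B. x' < X \<omega>}"
    if "x \<le> x'" and eq: "cdf (distr M borel X) x = cdf (distr M borel X) x'" for x x'
  proof -
    interpret R: real_distribution "distr M borel X"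
      by (rule real_distribution_distr) simp
    have "measure (distr M borel X) {x<..x'} = 0"
    proof (cases "x < x'")
      case True
      then show ?thesis using R.cdf_diff_eq[OF True] eq by simp
    qed simp
    then have null: "prob {\<omega> \<in> space M. x < X \<omega> \<and> X \<omega> \<le> x'} = 0"
      by (simp add: measure_distr vimage_def Int_def conj_ac)
    have sub: "B \<subseteq> space M" using B by (rule sets.sets_into_space)
    have [measurable]: "{\<omega> \<in> B. z < X \<omega>} \<in> events" for z
    proof -
      have "{\<omega> \<in> B. z < X \<omega>} = B \<inter> {\<omega> \<in> space M. z < X \<omega>}" using sub by auto
      then show ?thesis by simp
    qed
    have "prob {\<omega> \<in> B. x < X \<omega>} \<le>
        prob ({\<omega> \<in> B. x' < X \<omega>} \<union> {\<omega> \<in> space M. x < X \<omega> \<and> X \<omega> \<le> x'})"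
      using sub by (intro finite_measure_mono) auto
    also have "\<dots> \<le> prob {\<omega> \<in> B. x' < X \<omega>} + 0"
      unfolding null[symmetric] by (intro measure_Un_le) auto
    finally have "prob {\<omega> \<in> B. x < X \<omega>} \<le> prob {\<omega> \<in> B. x' < X \<omega>}" by simp
    moreover have "prob {\<omega> \<in> B. x' < X \<omega>} \<le> prob {\<omega> \<in> B. x < X \<omega>}"
      using that by (intro finite_measure_mono) auto
    ultimately show ?thesis by simp
  qed
  show ?thesis
  proof (cases "x \<le> x'")
    case True
    then show ?thesis using eq by (rule le)
  next
    case False
    then have "x' \<le> x" by simp
    then show ?thesis using eq[symmetric] by (rule le[symmetric])
  qed
qed

text \<open>The joint exceedance probability depends on the thresholds only through the marginal
  distribution functions, so any choice of preimages defines \<open>P\<close>; off the ranges its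
  values are arbitrary.\<close>

lemma (in prob_space) exceedance_fn_exists:
  assumes X [measurable]: "X \<in> borel_measurable M" and Y [measurable]: "Y \<in> borel_measurable M"
  shows "\<exists>P. is_exceedance_fn M X Y P"
proof -
  define G where "G x y = prob {\<omega> \<in> space M. x < X \<omega> \<and> y < Y \<omega>}" for x y
  let ?F = "cdf (distr M borel X)" and ?H = "cdf (distr M borel Y)"
  have G1: "G x y = G x' y" if "?F x = ?F x'" for x x' y
  proof -
    have "{\<omega> \<in> space M. y < Y \<omega>} \<in> events" by simp
    from prob_exceed_cong[OF X this that] show ?thesis by (simp add: G_def conj_ac)
  qed
  have G2: "G x y = G x y'" if "?H y = ?H y'" for x y y'
  proof -
    have "{\<omega> \<in> space M. x < X \<omega>} \<in> events" by simp
    from prob_exceed_cong[OF Y this that] show ?thesis by (simp add: G_def conj_ac)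
  qed
  have "is_exceedance_fn M X Y (\<lambda>u v. G (SOME x. ?F x = u) (SOME y. ?H y = v))"
    unfolding is_exceedance_fn_def G_def[symmetric]
    by (metis (mono_tags, lifting) G1 G2 someI)
  then show ?thesis by blast
qed

text \<open>Continuity of the marginals supplies, for each \<open>s\<close> in the open unit
  interval, thresholds that are exceeded with probability exactly \<open>s\<close>. This turns the
  condition on \<open>P\<close> into one on tail probabilities.\<close>

lemma (in prob_space) asymp_independentI:
  assumes X [measurable]: "X \<in> borel_measurable M" and Y [measurable]: "Y \<in> borel_measurable M"
    and atomless: "\<And>x. prob {\<omega> \<in> space M. X \<omega> = x} = 0" "\<And>y. prob {\<omega> \<in> space M. Y \<omega> = y} = 0"
    and tail: "\<And>\<eta>. 0 < \<eta> \<Longrightarrow> \<exists>s0>0. \<forall>s x y. 0 < s \<longrightarrow> s < s0 \<longrightarrow>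
      prob {\<omega> \<in> space M. x < X \<omega>} = s \<longrightarrow> prob {\<omega> \<in> space M. y < Y \<omega>} = s \<longrightarrow>
      prob {\<omega> \<in> space M. x < X \<omega> \<and> y < Y \<omega>} \<le> \<eta> * s"
  shows "asymp_independent M X Y"
proof -
  have cont: "continuous_on UNIV (cdf (distr M borel Z))"
    if [measurable]: "Z \<in> borel_measurable M" and "\<And>x. prob {\<omega> \<in> space M. Z \<omega> = x} = 0" for Z
  proof -
    interpret R: real_distribution "distr M borel Z"
      by (rule real_distribution_distr) simp
    have "measure (distr M borel Z) {x} = 0" for x
      using that(2)[of x] by (simp add: measure_distr vimage_def Int_def conj_commute)
    then show ?thesis
      by (intro continuous_at_imp_continuous_on ballI) (simp add: R.isCont_cdf)
  qed
  have quantile: "\<exists>x. cdf (distr M borel Z) x = 1 - s \<and> prob {\<omega> \<in> space M. x < Z \<omega>} = s"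
    if Z [measurable]: "Z \<in> borel_measurable M" and null: "\<And>x. prob {\<omega> \<in> space M. Z \<omega> = x} = 0"
      and s: "0 < s" "s < 1" for Z s
  proof -
    obtain x where x: "cdf (distr M borel Z) x = 1 - s"
      using cdf_attains[OF prob_space_axioms Z cont[OF Z null], of "1 - s"] s by auto
    have "cdf (distr M borel Z) x = prob {\<omega> \<in> space M. Z \<omega> \<le> x}"
      by (simp add: cdf_def2 measure_distr vimage_def Int_def conj_commute)
    moreover have "prob {\<omega> \<in> space M. x < Z \<omega>} = 1 - prob {\<omega> \<in> space M. Z \<omega> \<le> x}"
      by (subst prob_neg[symmetric]) (auto simp: not_le)
    ultimately show ?thesis using x by auto
  qed
  obtain P where P: "is_exceedance_fn M X Y P" using exceedance_fn_exists[OF X Y] by blast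
  have "(\<lambda>s. P (1 - s) (1 - s)) \<in> o[at_right 0](\<lambda>s. s)"
  proof (rule landau_o.smallI)
    fix \<eta> :: real assume "0 < \<eta>"
    then obtain s0 where s0: "0 < s0" and small: "\<And>s x y. 0 < s \<Longrightarrow> s < s0 \<Longrightarrow>
      prob {\<omega> \<in> space M. x < X \<omega>} = s \<Longrightarrow> prob {\<omega> \<in> space M. y < Y \<omega>} = s \<Longrightarrow>
      prob {\<omega> \<in> space M. x < X \<omega> \<and> y < Y \<omega>} \<le> \<eta> * s"
      using tail by blast
    \<comment> \<open>The cap 1 keeps \<open>1 - s\<close> inside the open unit interval, where the
      quantiles exist.\<close>
    have "\<forall>\<^sub>F s in at_right 0. s \<in> {0<..<min s0 1}"
      using s0 by (intro eventually_at_right_real) simp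
    then show "\<forall>\<^sub>F s in at_right 0. norm (P (1 - s) (1 - s)) \<le> \<eta> * norm s"
    proof eventually_elim
      case (elim s)
      then have s: "0 < s" "s < s0" "s < 1" by auto
      obtain x y where x: "cdf (distr M borel X) x = 1 - s" "prob {\<omega> \<in> space M. x < X \<omega>} = s"
        and y: "cdf (distr M borel Y) y = 1 - s" "prob {\<omega> \<in> space M. y < Y \<omega>} = s"
        using quantile[OF X atomless(1) s(1,3)] quantile[OF Y atomless(2) s(1,3)] by blast
      have "P (1 - s) (1 - s) = prob {\<omega> \<in> space M. x < X \<omega> \<and> y < Y \<omega>}"
        using P x y unfolding is_exceedance_fn_def by metis
      then show ?case using small[OF s(1,2) x(2) y(2)] s by simp
    qed
  qed
  then show ?thesis
    unfolding asymp_independent_def using P X Y cont atomless by blast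
qed

theorem theorem3p10:
  fixes M :: "'w measure" and X :: "'w \<Rightarrow> real ^ 'd"
    and D :: "(real ^ 'd) set" and f :: "real ^ 'd \<Rightarrow> real" and a b :: "real ^ 'd"
  assumes "prob_space M"
    and "D \<in> class_D" and "convex D" and "smooth_boundary D"
    and "distributed M lborel X (\<lambda>x. ennreal (f x))"
    and "f \<in> class_H D \<and> light_tailed D f \<or> f \<in> class_A D"
    and "norm a = 1" and "norm b = 1" and "a \<noteq> b"
  shows "asymp_independent M (\<lambda>\<omega>. a \<bullet> X \<omega>) (\<lambda>\<omega>. b \<bullet> X \<omega>)"
proof -
  interpret prob_space M by fact
  obtain c r where "level_sandwich D f c r"
    using assms(2,6) light_tailed_level_sandwich class_A_level_sandwich by blast
  then interpret L: level_sandwich D f c r .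
  have X [measurable]: "X \<in> borel_measurable M"
    using distributed_measurable[OF assms(5)] by simp
  have transfer: "prob {\<omega> \<in> space M. Q (X \<omega>)} = measure L.N {x. Q x}"
    if "{x. Q x} \<in> sets borel" for Q
  proof -
    have "measure L.N {x. Q x} = measure (distr M lborel X) {x. Q x}"
      using assms(5) by (simp add: distributed_distr_eq_density)
    also have "\<dots> = prob {\<omega> \<in> space M. Q (X \<omega>)}"
      using that by (simp add: measure_distr vimage_def Int_def conj_commute)
    finally show ?thesis by simp
  qed
  \<comment> \<open>A hyperplane is Lebesgue null, hence null for the law of \<open>X\<close>, which
    has a density.\<close>
  have atomless: "prob {\<omega> \<in> space M. u \<bullet> X \<omega> = x} = 0" if "norm u = 1" for u x
  proof -
    have "{z. u \<bullet> z = x} \<in> null_sets lborel"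
    proof -
      have "{z. u \<bullet> z = x} \<in> null_sets lebesgue"
        unfolding negligible_iff_null_sets[symmetric]
        using that by (intro negligible_hyperplane) auto
      then show ?thesis
        by (subst (asm) null_sets_completion_iff) (auto simp: closed_hyperplane borel_closed)
    qed
    then have "{z. u \<bullet> z = x} \<in> null_sets L.N"
      using absolutely_continuousI_density[of "\<lambda>x. ennreal (f x)" lborel] L.f_meas
      by (auto simp: absolutely_continuous_def)
    then show ?thesis
      by (subst transfer) (auto simp: measure_eq_0_null_sets)
  qed
  define \<alpha> where "\<alpha> = (SUP x\<in>D. a \<bullet> x)"
  define \<beta> where "\<beta> = (SUP x\<in>D. b \<bullet> x)"
  have bdd: "bdd_above ((\<bullet>) u ` D)" for u
    using L.bounded_D by (intro bounded_imp_bdd_above bounded_linear_image bounded_linear_inner_right)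
  have le: "x \<in> D \<Longrightarrow> a \<bullet> x \<le> \<alpha>" "x \<in> D \<Longrightarrow> b \<bullet> x \<le> \<beta>" for x
    unfolding \<alpha>_def \<beta>_def by (auto intro!: cSUP_upper bdd)
  have approx: "z < \<alpha> \<Longrightarrow> \<exists>x\<in>D. z < a \<bullet> x" "z < \<beta> \<Longrightarrow> \<exists>x\<in>D. z < b \<bullet> x" for z
    unfolding \<alpha>_def \<beta>_def using less_cSUP_iff[OF L.nonempty_D bdd] by auto
  have zero: "0 \<in> closure D"
    using L.star_D L.nonempty_D by (rule zero_in_closure_star_shaped)
  \<comment> \<open>The origin lies in the closure of \<open>D\<close>, and the support bounds
    extend to the closure.\<close>
  have nonneg: "0 \<le> \<alpha>" "0 \<le> \<beta>"
    using inner_le_on_closure[OF le(1) zero] inner_le_on_closure[OF le(2) zero] by simp_all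
  obtain \<delta> where \<delta>: "0 < \<delta>" "\<And>x. x \<in> D \<Longrightarrow> a \<bullet> x \<le> \<alpha> - \<delta> \<or> b \<bullet> x \<le> \<beta> - \<delta>"
    using contact_faces_separated[OF L.open_D L.bounded_D L.nonempty_D assms(4,7-9) le] by blast
  have half: "prob {\<omega> \<in> space M. x < u \<bullet> X \<omega>} = measure L.N {z. x < u \<bullet> z}" for u x
    by (rule transfer[of "\<lambda>z. x < u \<bullet> z"]) simp
  have both: "prob {\<omega> \<in> space M. x < a \<bullet> X \<omega> \<and> y < b \<bullet> X \<omega>} =
      measure L.N {z. x < a \<bullet> z \<and> y < b \<bullet> z}" for x y
    by (rule transfer[of "\<lambda>z. x < a \<bullet> z \<and> y < b \<bullet> z"]) simp
  show ?thesis
  proof (rule asymp_independentI)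
    fix \<eta> :: real assume "0 < \<eta>"
    then show "\<exists>s0>0. \<forall>s x y. 0 < s \<longrightarrow> s < s0 \<longrightarrow>
      prob {\<omega> \<in> space M. x < a \<bullet> X \<omega>} = s \<longrightarrow> prob {\<omega> \<in> space M. y < b \<bullet> X \<omega>} = s \<longrightarrow>
      prob {\<omega> \<in> space M. x < a \<bullet> X \<omega> \<and> y < b \<bullet> X \<omega>} \<le> \<eta> * s"
      using L.joint_exceedance_small[OF approx nonneg \<delta>(1) _ \<delta>(2)] by (simp add: half both)
  qed (use atomless assms(7,8) in auto)
qed

end
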